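(* Let $X$ be a filtered partially ordered set and $\Lambda$ a totally ordered set. Assume that both $X$ and $\Lambda$ are endowed with a topology for which intervals are compact and the partial orders are upper semicontinuous. Let $u:X\to\Lambda$ be a function with closed and lower bounded upper level sets, that is, all the sets $\{x\in X:u(x)\geqslant\lambda\}$, $\lambda\in\Lambda$, are closed and bounded below in $X$. Then $u$ is a regular quasi-Leontief function if and only if it is isotone and has Property $(\Phi)$.
   Context: A partially ordered set $L$ is filtered if for all $l_1,l_2\in L$ there is $l_3\in L$ with $l_1\geqslant l_3$ and $l_2\geqslant l_3$. Intervals are the sets $[x_1,x_2]=\{x:x_1\leqslant x\leqslant x_2\}$. A partial order on a topological space is upper semicontinuous if all sets of the form $\uparrow(x)=\{x':x'\geqslant x\}$ are closed. $u$ is isotone if $x'\geqslant x$ implies $u(x')\geqslant u(x)$. $u:X\to\Lambda$ is quasi-Leontief if for every $x\in X$ there is $x^\circ\in X$ with $\{x'\in X:u(x')\geqslant u(x)\}=\{x'\in X:x'\geqslant x^\circ\}$. A quasi-Leontief function $u$ is regular if for every $\lambda\in\Lambda$ the set $\{x\in X:u(x)\geqslant\lambda\}$ is either empty or has a smallest element. Property $(\Phi)$: for all $x,x'\in X$ there exists $x''\in X$ such that $x\geqslant x''$, $x'\geqslant x''$ and $\min\{u(x),u(x')\}=u(x'')$.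
   Formalization: "Compact" intervals are taken to be compact and Hausdorff (as subspaces); with mere quasi-compactness the claim fails, e.g. for the indicator of (0,1] on the chain {-1} ∪ (0,1] whose closed sets are the up-sets. *)

theory Defs
  imports "HOL-Analysis.Analysis"
begin

definition filtered :: "'a::order set \<Rightarrow> bool" where
  "filtered L \<longleftrightarrow> (\<forall>l1\<in>L. \<forall>l2\<in>L. \<exists>l3\<in>L. l1 \<ge> l3 \<and> l2 \<ge> l3)"

text \<open>
  Compactness is understood to include the Hausdorff separation axiom
  (Bourbaki), imposed here only on the subspace. It cannot be dropped: on the chain
  consisting of \<open>-1\<close> and the reals of \<open>(0,1]\<close>, with the up-sets as closed sets, every
  interval satisfies \<^const>\<open>compact\<close> and every principal up-set is closed, but the
  indicator function of \<open>(0,1]\<close>, which is isotone and has Property \<open>\<Phi>\<close>, has an upper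
  level set without a smallest element.
\<close>

definition compact_Hausdorff :: "'a::topological_space set \<Rightarrow> bool" where
  "compact_Hausdorff S \<longleftrightarrow> compact S \<and> Hausdorff_space (top_of_set S)"

definition upper_level :: "('a \<Rightarrow> 'b::order) \<Rightarrow> 'b \<Rightarrow> 'a set" where
  "upper_level u l = {x. u x \<ge> l}"

definition quasi_Leontief :: "('a::order \<Rightarrow> 'b::linorder) \<Rightarrow> bool" where
  "quasi_Leontief u \<longleftrightarrow> (\<forall>x. \<exists>x0. {x'. u x' \<ge> u x} = {x'. x' \<ge> x0})"

definition regular_quasi_Leontief :: "('a::order \<Rightarrow> 'b::linorder) \<Rightarrow> bool" where
  "regular_quasi_Leontief u \<longleftrightarrow> quasi_Leontief u \<and>
     (\<forall>l. upper_level u l = {} \<or> (\<exists>m\<in>upper_level u l. \<forall>y\<in>upper_level u l. m \<le> y))"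

definition property_Phi :: "('a::order \<Rightarrow> 'b::linorder) \<Rightarrow> bool" where
  "property_Phi u \<longleftrightarrow> (\<forall>x x'. \<exists>x''. x \<ge> x'' \<and> x' \<ge> x'' \<and> min (u x) (u x') = u x'')"

end

theory Submission
  imports Defs
begin

text \<open>
  For the nontrivial direction, Property \<open>\<Phi>\<close> makes a nonempty upper level set \<open>U\<close>
  downward directed. If \<open>b\<close> is a lower bound of \<open>U\<close> and \<open>a \<in> U\<close>, then the traces
  \<open>U \<inter> {b..y}\<close> with \<open>y \<in> U\<close>, \<open>y \<le> a\<close>, are closed in the compact interval \<open>{b..a}\<close> and have the
  finite intersection property. A common point of all of them is the smallest element of \<open>U\<close>.
\<close>

text \<open>Iterating the two-element condition yields the finite intersection property used below;
  nonemptiness of \<open>L\<close> serves the empty \<open>F\<close>.\<close>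

lemma filtered_finite_lower_bound:
  assumes "filtered L" "L \<noteq> {}" "finite F" "F \<subseteq> L"
  shows "\<exists>z\<in>L. \<forall>y\<in>F. z \<le> y"
  using assms(3,4)
proof (induction F rule: finite_induct)
  case empty
  then show ?case using \<open>L \<noteq> {}\<close> by auto
next
  case (insert x F)
  then obtain z where "z \<in> L" "\<forall>y\<in>F. z \<le> y" by auto
  moreover obtain w where "w \<in> L" "w \<le> x" "w \<le> z"
    using \<open>filtered L\<close> \<open>z \<in> L\<close> insert.prems unfolding filtered_def by blast
  ultimately have "\<forall>y\<in>insert x F. w \<le> y" using order_trans[of w z] by blast
  with \<open>w \<in> L\<close> show ?case ..
qed

lemma filtered_closed_has_least:
  fixes U :: "'a::{order,topological_space} set"
  assumes interval: "\<And>a b :: 'a. compact_Hausdorff {a..b}"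
    and "closed U" "bdd_below U" "filtered U" "U \<noteq> {}"
  shows "\<exists>m\<in>U. \<forall>y\<in>U. m \<le> y"
proof -
  obtain b where b: "\<And>y. y \<in> U \<Longrightarrow> b \<le> y"
    using \<open>bdd_below U\<close> by (auto simp: bdd_below_def)
  obtain a where a: "a \<in> U" using \<open>U \<noteq> {}\<close> by auto
  define T where "T = top_of_set {b..a}"
  define V where "V = {y \<in> U. y \<le> a}"
  define K where "K = (\<lambda>y. U \<inter> {b..y})"
  have "compact_space T" and Haus: "Hausdorff_space T"
    using interval[of b a]
    by (auto simp: compact_Hausdorff_def T_def compact_space_subtopology)
  have "closedin T (K y)" if "y \<in> V" for y
  proof -
    have sub: "{b..y} \<subseteq> {b..a}" using that by (auto simp: V_def)
    \<comment> \<open>Initial segments need not be closed in the whole space; the Hausdorff axiom on the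
      interval is what closes its initial segments.\<close>
    have "closedin T {b..y}"
      using interval[of b y] sub Haus
      by (intro compactin_imp_closedin) (auto simp: compact_Hausdorff_def T_def compactin_subtopology)
    moreover have "closedin T ({b..a} \<inter> U)"
      unfolding T_def using \<open>closed U\<close> by (rule closedin_closed_Int)
    moreover have "K y = {b..y} \<inter> ({b..a} \<inter> U)" using sub by (auto simp: K_def)
    ultimately show ?thesis by (simp add: closedin_Int)
  qed
  then have "\<forall>C\<in>K ` V. closedin T C" by blast
  moreover have "\<Inter> \<F> \<noteq> {}" if "finite \<F>" "\<F> \<subseteq> K ` V" for \<F>
  proof -
    obtain F where F: "F \<subseteq> V" "finite F" "\<F> = K ` F"
      using finite_subset_image[OF \<open>finite \<F>\<close> \<open>\<F> \<subseteq> K ` V\<close>] by auto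
    \<comment> \<open>One element \<open>z\<close> of \<open>U\<close> below all of \<open>F\<close>
      lies in every trace \<open>K y\<close> with \<open>y \<in> F\<close>, because \<open>b\<close>
      bounds \<open>U\<close> from below.\<close>
    then obtain z where "z \<in> U" "\<forall>y\<in>F. z \<le> y"
      using filtered_finite_lower_bound[OF \<open>filtered U\<close> \<open>U \<noteq> {}\<close>, of F] by (auto simp: V_def)
    then have "z \<in> \<Inter> \<F>" using b F(3) by (auto simp: K_def)
    then show ?thesis by blast
  qed
  ultimately have "\<Inter> (K ` V) \<noteq> {}"
    using \<open>compact_space T\<close>[unfolded compact_space_fip, rule_format, of "K ` V"] by simp
  then obtain m where "m \<in> \<Inter> (K ` V)" by blast
  then have m: "m \<in> U \<and> m \<le> y" if "y \<in> V" for y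
    using that unfolding K_def by fastforce
  \<comment> \<open>An arbitrary \<open>y \<in> U\<close> need not be comparable with
    \<open>a\<close>; directedness supplies \<open>z \<in> V\<close> below \<open>y\<close>, and
    \<open>m \<le> z\<close>.\<close>
  have "m \<le> y" if "y \<in> U" for y
  proof -
    obtain z where "z \<in> U" "z \<le> y" "z \<le> a"
      using \<open>filtered U\<close> \<open>y \<in> U\<close> a unfolding filtered_def by blast
    then show ?thesis using m[of z] by (auto simp: V_def)
  qed
  moreover have "m \<in> U" using m[of a] a by (simp add: V_def)
  ultimately show ?thesis by blast
qed

text \<open>If two values are at least \<open>l\<close>, so is their minimum, hence the point given
  by \<open>\<Phi>\<close> stays in the level set.\<close>

lemma property_Phi_filtered_upper_level:
  assumes "property_Phi u"
  shows "filtered (upper_level u l)"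
  unfolding filtered_def
proof (intro ballI)
  fix x y assume "x \<in> upper_level u l" "y \<in> upper_level u l"
  moreover obtain z where "z \<le> x" "z \<le> y" "min (u x) (u y) = u z"
    using assms unfolding property_Phi_def by blast
  ultimately have "z \<in> upper_level u l"
    by (metis upper_level_def mem_Collect_eq min.boundedI)
  with \<open>z \<le> x\<close> \<open>z \<le> y\<close> show "\<exists>z\<in>upper_level u l. z \<le> x \<and> z \<le> y" by blast
qed

text \<open>The level set of \<open>u x\<close> is a principal up-set containing \<open>x\<close>,
  hence it contains everything above \<open>x\<close>.\<close>

lemma quasi_Leontief_mono:
  assumes "quasi_Leontief u"
  shows "mono u"
proof (rule monoI)
  fix x y :: 'a assume "x \<le> y"
  obtain x0 where x0: "\<And>z. u x \<le> u z \<longleftrightarrow> x0 \<le> z"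
    using assms unfolding quasi_Leontief_def by blast
  have "x0 \<le> x" using x0[of x] by simp
  then have "x0 \<le> y" using \<open>x \<le> y\<close> by (rule order_trans)
  then show "u x \<le> u y" using x0 by simp
qed

lemma quasi_Leontief_property_Phi:
  assumes "quasi_Leontief u"
  shows "property_Phi u"
proof -
  \<comment> \<open>The witness is the generator \<open>x0\<close> of the level set of the smaller
    value \<open>u x\<close>: both points lie above it, and \<open>u x0 = u x\<close> by
    isotonicity.\<close>
  have descend: "\<exists>z. z \<le> x \<and> z \<le> y \<and> u z = u x" if "u x \<le> u y" for x y
  proof -
    obtain x0 where x0: "\<And>z. u x \<le> u z \<longleftrightarrow> x0 \<le> z"
      using assms unfolding quasi_Leontief_def by blast
    have "x0 \<le> x" "x0 \<le> y" "u x \<le> u x0"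
      using x0[of x] x0[of y] x0[of x0] that by simp_all
    moreover have "u x0 \<le> u x"
      using quasi_Leontief_mono[OF assms] \<open>x0 \<le> x\<close> by (rule monoD)
    ultimately show ?thesis by force
  qed
  show ?thesis unfolding property_Phi_def
  proof (intro allI)
    fix x y
    show "\<exists>z. z \<le> x \<and> z \<le> y \<and> min (u x) (u y) = u z"
    proof (cases "u x \<le> u y")
      case True
      with descend[of x y] show ?thesis by auto
    next
      case False
      with descend[of y x] show ?thesis by (metis min.absorb2 linear)
    qed
  qed
qed

theorem theorem2p2p3:
  fixes u :: "'a::{order,topological_space} \<Rightarrow> 'b::{linorder,topological_space}"
  assumes "filtered (UNIV :: 'a set)"
    and "\<And>a b :: 'a. compact_Hausdorff {a..b}"
    and "\<And>a :: 'a. closed {a..}"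
    and "\<And>a b :: 'b. compact_Hausdorff {a..b}"
    and "\<And>a :: 'b. closed {a..}"
    and "\<And>l. closed (upper_level u l)"
    and "\<And>l. bdd_below (upper_level u l)"
  shows "regular_quasi_Leontief u \<longleftrightarrow> mono u \<and> property_Phi u"
proof
  assume "regular_quasi_Leontief u"
  then show "mono u \<and> property_Phi u"
    by (simp add: regular_quasi_Leontief_def quasi_Leontief_mono quasi_Leontief_property_Phi)
next
  assume u: "mono u \<and> property_Phi u"
  \<comment> \<open>Used twice: for every \<open>l\<close> it is regularity, and at
    \<open>l = u x\<close> the least element becomes the generator \<open>x0\<close>.\<close>
  have least: "\<exists>m\<in>upper_level u l. \<forall>y\<in>upper_level u l. m \<le> y"
    if "upper_level u l \<noteq> {}" for l
    using filtered_closed_has_least[OF assms(2,6,7) property_Phi_filtered_upper_level that] u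
    by simp
  have "\<exists>x0. {x'. u x' \<ge> u x} = {x'. x' \<ge> x0}" for x
  proof -
    have "upper_level u (u x) \<noteq> {}" by (auto simp: upper_level_def)
    from least[OF this] obtain m where m: "u x \<le> u m" "\<And>y. u x \<le> u y \<Longrightarrow> m \<le> y"
      by (auto simp: upper_level_def)
    \<comment> \<open>Isotonicity makes the level set upward closed, so it is the whole up-set of
      its least element \<open>m\<close>.\<close>
    have "u x \<le> u y" if "m \<le> y" for y
      using m(1) monoD[OF conjunct1[OF u] that] by (rule order_trans)
    then have "{x'. u x' \<ge> u x} = {x'. x' \<ge> m}" using m(2) by blast
    then show ?thesis ..
  qed
  then show "regular_quasi_Leontief u"
    using least unfolding regular_quasi_Leontief_def quasi_Leontief_def by blast
qed

end
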